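(* There is an infinite family of (pairwise non-isomorphic) 3-connected cubic graphs having no good coloring.
   Context: Graphs are finite, simple and undirected. A graph is cubic if every vertex has degree 3. Good coloring: a good coloring of a graph is a 2-coloring of its vertices in colors blue and red (not required to be proper) such that (1) the subgraph induced by the blue vertices has maximum degree at most 1; (2) the subgraph induced by the red vertices has minimum degree at least 1 (every red vertex has a red neighbor); (3) the subgraph induced by the red vertices contains no path on 4 vertices (as a not necessarily induced subgraph). *)

theory Defs
  imports "Graph_Theory.Graph_Theory"
begin

text \<open>
  As usual in the graph library, a finite simple undirected graph is a finite loop-free
  symmetric digraph without parallel arcs. Each edge is thus a pair of opposite arcs, and the
  degree of a vertex is its out-degree, not the sum of its in-degree and its out-degree.
\<close>

definition cubic :: "('a, 'b) pre_digraph \<Rightarrow> bool" where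
  "cubic G \<longleftrightarrow> (\<forall>v\<in>verts G. out_degree G v = 3)"

text \<open>
  The number of vertices is taken with \<^const>\<open>card\<close>, so the definition is meant for finite graphs.
\<close>

definition k_connected :: "nat \<Rightarrow> ('a, 'b) pre_digraph \<Rightarrow> bool" where
  "k_connected k G \<longleftrightarrow> card (verts G) > k \<and>
     (\<forall>S. S \<subseteq> verts G \<and> finite S \<and> card S < k \<longrightarrow> connected (G \<restriction> (verts G - S)))"

datatype colour = Blue | Red

definition colour_class :: "('a, 'b) pre_digraph \<Rightarrow> ('a \<Rightarrow> colour) \<Rightarrow> colour \<Rightarrow> 'a set" where
  "colour_class G c x = {v \<in> verts G. c v = x}"

text \<open>
  A \<^const>\<open>vpath\<close> is a list of distinct vertices of which consecutive ones are adjacent, so its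
  \<^const>\<open>length\<close> is the number of vertices; further arcs between them are allowed.
\<close>

definition good_colouring :: "('a, 'b) pre_digraph \<Rightarrow> ('a \<Rightarrow> colour) \<Rightarrow> bool" where
  "good_colouring G c \<longleftrightarrow>
     (let B = G \<restriction> colour_class G c Blue; R = G \<restriction> colour_class G c Red in
       (\<forall>v\<in>verts B. out_degree B v \<le> 1) \<and>
       (\<forall>v\<in>verts R. out_degree R v \<ge> 1) \<and>
       \<not> (\<exists>p. vpath p R \<and> length p = 4))"

end

theory Submission
  imports Defs
begin

text \<open>
  The graphs are necklaces: a ring of \<open>m\<close> gadgets, for odd \<open>m \<ge> 3\<close>. A gadget has eight
  vertices. The vertices \<open>0, 1, 2, 3\<close> form a 4-cycle, the vertex \<open>j\<close> of this cycle is joined to the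
  port \<open>j + 4\<close>, and the ports \<open>4, 6\<close> and \<open>5, 7\<close> are adjacent. Each port has one further neighbour,
  its outer neighbour: the ports \<open>6\<close> and \<open>7\<close> of each gadget are linked to the ports \<open>4\<close> and \<open>5\<close> of
  the next one.

  A necklace with an odd number of gadgets has no good colouring for the following reason. In every
  good colouring a gadget has at least as many red outer neighbours as it has red ports, and when the
  two numbers agree, exactly one of the ports \<open>4\<close> and \<open>6\<close> is red and the port \<open>6\<close> has the colour of
  its outer neighbour (\<open>gadget_balance\<close>). Over the whole ring, however, the outer neighbours of the
  ports are all the ports again, each of them once, so that the two totals are equal and every
  gadget is balanced. Going from the port \<open>4\<close> of a gadget to its port \<open>6\<close> changes the colour, and
  going on to the port \<open>4\<close> of the next gadget preserves it. So the colours of the ports \<open>4\<close> alternate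
  around the ring, which is impossible for an odd number of gadgets.

  For 3-connectivity, let at most two vertices be removed. If they lie in one gadget, the other
  gadgets remain linked in a row, and each remaining vertex of the damaged gadget is still connected
  to a port of that gadget (\<open>gadget_minus_two_reaches_port\<close>). If they lie in two gadgets, each of these
  is still connected (\<open>gadget_minus_vertex_connected\<close>). As consecutive gadgets are joined by two
  disjoint links, the ring is then broken in at most one place.

  The members of the family are distinguished by their numbers of vertices.
\<close>

section \<open>Connectivity and good colourings through adjacency\<close>

text \<open>
  A set of vertices induces a connected graph if every predicate that is invariant along its arcs is
  constant: apply this to the predicate of being reachable from a given vertex. Connectivity proofs
  then need no explicit walks.
\<close>

lemma connected_inducedI:
  fixes G :: "'a pair_pre_digraph"
  assumes "K \<noteq> {}"
    and const: "\<And>(P :: 'a \<Rightarrow> bool) u v. (\<And>x y. x \<in> K \<Longrightarrow> y \<in> K \<Longrightarrow> (x, y) \<in> parcs G \<Longrightarrow> P x = P y) \<Longrightarrow>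
      u \<in> K \<Longrightarrow> v \<in> K \<Longrightarrow> P u = P v"
  shows "connected (with_proj G \<restriction> K)"
proof -
  let ?R = "(arcs_ends (with_proj G \<restriction> K))\<^sup>s"
  have arc: "x \<in> K \<and> y \<in> K \<and> ((x, y) \<in> ?R \<and> (y, x) \<in> ?R)"
    if "x \<in> K" "y \<in> K" "(x, y) \<in> parcs G" for x y
    using that by (auto simp: symcl_def arcs_ends_conv image_iff)
  have "(u, v) \<in> rtrancl_on K ?R" if u: "u \<in> K" and v: "v \<in> K" for u v
  proof -
    let ?P = "\<lambda>x. (u, x) \<in> rtrancl_on K ?R"
    have "?P u = ?P v"
    proof (rule const[of ?P, OF _ u v])
      fix x y assume xy: "x \<in> K" "y \<in> K" "(x, y) \<in> parcs G"
      show "?P x = ?P y"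
        using arc[OF xy] by (blast intro: rtrancl_on_into_rtrancl_on)
    qed
    moreover have "?P u" using u by (rule rtrancl_on_refl)
    ultimately show ?thesis by blast
  qed
  with assms(1) show ?thesis
    by (simp add: connected_conv)
qed

lemma out_arcs_induced:
  "out_arcs (with_proj G \<restriction> K) v = (if v \<in> K then Pair v ` {w \<in> K. (v, w) \<in> parcs G} else {})"
  by (auto simp: out_arcs_def image_iff)

lemma out_degree_induced:
  assumes "v \<in> K"
  shows "out_degree (with_proj G \<restriction> K) v = card {w \<in> K. (v, w) \<in> parcs G}"
  using assms unfolding out_degree_def out_arcs_induced by (simp add: card_image inj_on_def)

context pair_graph
begin

lemma good_colouring_blue:
  assumes "good_colouring (with_proj G) c" and "(v, x) \<in> parcs G" and "(v, y) \<in> parcs G" and "x \<noteq> y"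
  shows "c v = Red \<or> c x = Red \<or> c y = Red"
proof (rule ccontr)
  assume "\<not> ?thesis"
  then have blue: "c v = Blue" "c x = Blue" "c y = Blue"
    using colour.exhaust by blast+
  let ?B = "colour_class (with_proj G) c Blue"
  have in_B: "v \<in> ?B" "x \<in> ?B" "y \<in> ?B"
    using blue assms(2,3) wellformed' by (auto simp: colour_class_def)
  then have "out_degree (with_proj G \<restriction> ?B) v \<le> 1"
    using assms(1) by (auto simp: good_colouring_def Let_def)
  then have "card {w \<in> ?B. (v, w) \<in> parcs G} \<le> 1"
    using in_B by (simp add: out_degree_induced)
  moreover have "card {x, y} \<le> card {w \<in> ?B. (v, w) \<in> parcs G}"
    using in_B assms(2,3) pair_finite_verts
    by (intro card_mono) (auto simp: colour_class_def)
  ultimately show False using \<open>x \<noteq> y\<close> by simp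
qed

lemma good_colouring_red:
  assumes "good_colouring (with_proj G) c" and "v \<in> pverts G" and "c v = Red"
  shows "\<exists>w. (v, w) \<in> parcs G \<and> c w = Red"
proof -
  let ?R = "colour_class (with_proj G) c Red"
  have in_R: "v \<in> ?R" using assms(2,3) by (simp add: colour_class_def)
  then have "1 \<le> out_degree (with_proj G \<restriction> ?R) v"
    using assms(1) by (auto simp: good_colouring_def Let_def)
  then have "card {w \<in> ?R. (v, w) \<in> parcs G} \<noteq> 0"
    using in_R by (simp add: out_degree_induced)
  then obtain w where "w \<in> ?R" "(v, w) \<in> parcs G"
    by (metis (no_types, lifting) card.empty empty_Collect_eq)
  then show ?thesis by (auto simp: colour_class_def)
qed

lemma good_colouring_path:
  assumes good: "good_colouring (with_proj G) c"
    and arcs: "(x, u) \<in> parcs G" "(u, v) \<in> parcs G" "(v, y) \<in> parcs G"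
    and dist: "distinct [x, u, v, y]"
  shows "\<not> (c x = Red \<and> c u = Red \<and> c v = Red \<and> c y = Red)"
proof
  assume red: "c x = Red \<and> c u = Red \<and> c v = Red \<and> c y = Red"
  let ?R = "colour_class (with_proj G) c Red"
  have "x \<in> ?R" "u \<in> ?R" "v \<in> ?R" "y \<in> ?R"
    using red arcs wellformed' by (auto simp: colour_class_def)
  then have "vpath [x, u, v, y] (with_proj G \<restriction> ?R)"
    using arcs dist by (auto simp: vpath_def vwalk_def arcs_ends_conv image_iff)
  moreover have "length [x, u, v, y] = 4" by simp
  ultimately show False
    using good unfolding good_colouring_def Let_def by blast
qed

end

section \<open>The gadget\<close>

text \<open>
  The next two predicates are what a good colouring demands around a vertex and around an edge, with
  \<^const>\<open>True\<close> for red. In \<open>vertex_ok v x y z\<close> the vertex \<open>v\<close> has the neighbours \<open>x\<close>, \<open>y\<close> and \<open>z\<close>. One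
  of them must be red whatever the colour of \<open>v\<close>, as a red vertex has a red neighbour and a blue one
  has at most one blue neighbour. In \<open>edge_ok u x x' v y y'\<close> the vertex \<open>u\<close> has the neighbours \<open>x\<close>,
  \<open>x'\<close>, \<open>v\<close>, and \<open>v\<close> has the neighbours \<open>y\<close>, \<open>y'\<close>, \<open>u\<close>; there must be no red path with middle edge
  \<open>uv\<close>.
\<close>

definition vertex_ok :: "bool \<Rightarrow> bool \<Rightarrow> bool \<Rightarrow> bool \<Rightarrow> bool" where
  "vertex_ok v x y z \<longleftrightarrow> (x \<or> y \<or> z) \<and> (v \<or> x \<and> y \<or> x \<and> z \<or> y \<and> z)"

definition edge_ok :: "bool \<Rightarrow> bool \<Rightarrow> bool \<Rightarrow> bool \<Rightarrow> bool \<Rightarrow> bool \<Rightarrow> bool" where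
  "edge_ok u x x' v y y' \<longleftrightarrow> \<not> (u \<and> v \<and> (x \<or> x') \<and> (y \<or> y'))"

text \<open>
  Here \<open>p\<close>, \<open>q\<close> and \<open>o\<close> stand for the vertices of the 4-cycle, the ports and their outer neighbours.
  The 4-cycle is not completely red, as it would contain a path on four vertices, and has no three blue
  vertices. Nor are just two opposite vertices \<open>p0\<close>, \<open>p2\<close> blue: then \<open>p1\<close> and \<open>p3\<close>, being red, need
  red neighbours \<open>q1\<close> and \<open>q3\<close>, and \<open>p1 q1 q3 p3\<close> is a red path. Up to symmetry two cases remain.

  If \<open>p0\<close> and \<open>p1\<close> are blue and \<open>p2\<close> and \<open>p3\<close> red, then \<open>q0\<close> and \<open>q1\<close> are red, as \<open>p0\<close> and \<open>p1\<close> already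
  have a blue neighbour. So \<open>q2\<close> is blue because of the path \<open>q0 q2 p2 p3\<close>, and \<open>q3\<close> likewise. The
  ports \<open>q0\<close> and \<open>q1\<close> have no red neighbour inside the gadget, and \<open>o0\<close> and \<open>o1\<close> are red. This is
  the first alternative.

  If only \<open>p0\<close> is blue, then \<open>p1 p2 p3\<close> is a red path, which forces \<open>q1\<close> and \<open>q3\<close> to be blue; as they
  are adjacent, \<open>o1\<close> and \<open>o3\<close> are red. The ports \<open>q0\<close> and \<open>q2\<close> are not both red because of the path
  \<open>q0 q2 p2 p1\<close>, and not both blue because \<open>q0\<close> would have the blue neighbours \<open>p0\<close> and \<open>q2\<close>. If \<open>q0\<close>
  is the red one, it needs \<open>o0\<close> as a red neighbour, and if \<open>q2\<close> is, then \<open>q0\<close> has the blue neighbour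
  \<open>p0\<close> and \<open>o0\<close> is red again. This is the second alternative: one red port and at least three red
  outer neighbours.
\<close>

lemma gadget_dichotomy:
  assumes "vertex_ok p0 p1 p3 q0" "vertex_ok p1 p0 p2 q1" "vertex_ok p2 p1 p3 q2" "vertex_ok p3 p0 p2 q3"
    and "vertex_ok q0 p0 q2 o0" "vertex_ok q1 p1 q3 o1" "vertex_ok q2 p2 q0 o2" "vertex_ok q3 p3 q1 o3"
    and "edge_ok p0 p3 q0 p1 p2 q1" "edge_ok p1 p0 q1 p2 p3 q2" "edge_ok p2 p1 q2 p3 p0 q3" "edge_ok p3 p2 q3 p0 p1 q0"
    and "edge_ok p0 p1 p3 q0 q2 o0" "edge_ok p1 p0 p2 q1 q3 o1" "edge_ok p2 p1 p3 q2 q0 o2" "edge_ok p3 p0 p2 q3 q1 o3"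
    and "edge_ok q0 p0 o0 q2 p2 o2" "edge_ok q1 p1 o1 q3 p3 o3"
  shows "(q0 \<noteq> q2 \<and> q1 \<noteq> q3 \<and> (q0 \<longrightarrow> o0) \<and> (q1 \<longrightarrow> o1) \<and> (q2 \<longrightarrow> o2) \<and> (q3 \<longrightarrow> o3)) \<or>
    (if q0 \<or> q2 then \<not> (q0 \<and> q2) \<and> \<not> q1 \<and> \<not> q3 \<and> o1 \<and> o3 \<and> (o0 \<or> o2)
     else q1 \<noteq> q3 \<and> o0 \<and> o2 \<and> (o1 \<or> o3))"
  using assms unfolding vertex_ok_def edge_ok_def by argo

text \<open>
  In the first alternative of \<open>gadget_dichotomy\<close> each of the two red ports has a red outer neighbour,
  and equality holds only if there are no other red outer neighbours. In the second one there are more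
  red outer neighbours than red ports.
\<close>

lemma gadget_balance:
  assumes "vertex_ok p0 p1 p3 q0" "vertex_ok p1 p0 p2 q1" "vertex_ok p2 p1 p3 q2" "vertex_ok p3 p0 p2 q3"
    and "vertex_ok q0 p0 q2 o0" "vertex_ok q1 p1 q3 o1" "vertex_ok q2 p2 q0 o2" "vertex_ok q3 p3 q1 o3"
    and "edge_ok p0 p3 q0 p1 p2 q1" "edge_ok p1 p0 q1 p2 p3 q2" "edge_ok p2 p1 q2 p3 p0 q3" "edge_ok p3 p2 q3 p0 p1 q0"
    and "edge_ok p0 p1 p3 q0 q2 o0" "edge_ok p1 p0 p2 q1 q3 o1" "edge_ok p2 p1 p3 q2 q0 o2" "edge_ok p3 p0 p2 q3 q1 o3"
    and "edge_ok q0 p0 o0 q2 p2 o2" "edge_ok q1 p1 o1 q3 p3 o3"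
  shows "of_bool q0 + of_bool q1 + of_bool q2 + of_bool q3
      \<le> (of_bool o0 + of_bool o1 + of_bool o2 + of_bool o3 :: nat)"
    and "of_bool q0 + of_bool q1 + of_bool q2 + of_bool q3
      = (of_bool o0 + of_bool o1 + of_bool o2 + of_bool o3 :: nat) \<Longrightarrow> o2 = q2 \<and> q0 = (\<not> q2)"
  using gadget_dichotomy[OF assms] by (auto split: if_splits)

definition gadget_edges :: "(nat \<times> nat) set" where
  "gadget_edges = {(0,1), (1,2), (2,3), (3,0), (0,4), (1,5), (2,6), (3,7), (4,6), (5,7)}"

text \<open>
  The vertices in \<open>T\<close> have been removed from the gadget. Spelling out the edges one by one makes the
  connectivity claims below propositional.
\<close>

lemma gadget_edges_invariant:
  assumes "\<forall>(j, k)\<in>gadget_edges. j \<notin> T \<longrightarrow> k \<notin> T \<longrightarrow> f j = f k"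
  shows "0 \<in> T \<or> 1 \<in> T \<or> f 0 = f 1" "1 \<in> T \<or> 2 \<in> T \<or> f 1 = f 2"
    "2 \<in> T \<or> 3 \<in> T \<or> f 2 = f 3" "3 \<in> T \<or> 0 \<in> T \<or> f 3 = f 0"
    "0 \<in> T \<or> 4 \<in> T \<or> f 0 = f 4" "1 \<in> T \<or> 5 \<in> T \<or> f 1 = f 5"
    "2 \<in> T \<or> 6 \<in> T \<or> f 2 = f 6" "3 \<in> T \<or> 7 \<in> T \<or> f 3 = f 7"
    "4 \<in> T \<or> 6 \<in> T \<or> f 4 = f 6" "5 \<in> T \<or> 7 \<in> T \<or> f 5 = f 7"
  using assms unfolding gadget_edges_def by blast+

lemma less_8_cases:
  assumes "j < (8 :: nat)"
  shows "j = 0 \<or> j = 1 \<or> j = 2 \<or> j = 3 \<or> j = 4 \<or> j = 5 \<or> j = 6 \<or> j = 7"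
  using assms by linarith

text \<open>
  The gadget has the Hamiltonian cycle \<open>4, 6, 2, 3, 7, 5, 1, 0\<close>, of which a path is left when a vertex is
  removed.
\<close>

lemma gadget_minus_vertex_connected:
  fixes f :: "nat \<Rightarrow> bool"
  assumes T: "T \<subseteq> {s}"
    and inv: "\<forall>(j, k)\<in>gadget_edges. j \<notin> T \<longrightarrow> k \<notin> T \<longrightarrow> f j = f k"
    and "j < 8" "k < 8" "j \<notin> T" "k \<notin> T"
  shows "f j = f k"
proof -
  have few: "a \<notin> T \<or> b \<notin> T" if "a \<noteq> b" for a b
    using T that by blast
  note e = gadget_edges_invariant[OF inv]
  \<comment> \<open>All values are compared with the one at \<open>0\<close>, or at \<open>1\<close> in case \<open>0\<close> is the removed vertex.\<close>
  have base: "f i = (if 0 \<in> T then f 1 else f 0)" if "i < 8" "i \<notin> T" for i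
  proof -
    have c: "0 \<notin> T \<or> 1 \<notin> T" "0 \<notin> T \<or> 2 \<notin> T"
      "0 \<notin> T \<or> 3 \<notin> T" "0 \<notin> T \<or> 4 \<notin> T" "0 \<notin> T \<or> 5 \<notin> T"
      "0 \<notin> T \<or> 6 \<notin> T" "0 \<notin> T \<or> 7 \<notin> T" "1 \<notin> T \<or> 2 \<notin> T"
      "1 \<notin> T \<or> 3 \<notin> T" "1 \<notin> T \<or> 4 \<notin> T" "1 \<notin> T \<or> 5 \<notin> T"
      "1 \<notin> T \<or> 6 \<notin> T" "1 \<notin> T \<or> 7 \<notin> T" "2 \<notin> T \<or> 3 \<notin> T"
      "2 \<notin> T \<or> 4 \<notin> T" "2 \<notin> T \<or> 5 \<notin> T" "2 \<notin> T \<or> 6 \<notin> T"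
      "2 \<notin> T \<or> 7 \<notin> T" "3 \<notin> T \<or> 4 \<notin> T" "3 \<notin> T \<or> 5 \<notin> T"
      "3 \<notin> T \<or> 6 \<notin> T" "3 \<notin> T \<or> 7 \<notin> T" "4 \<notin> T \<or> 5 \<notin> T"
      "4 \<notin> T \<or> 6 \<notin> T" "4 \<notin> T \<or> 7 \<notin> T" "5 \<notin> T \<or> 6 \<notin> T"
      "5 \<notin> T \<or> 7 \<notin> T" "6 \<notin> T \<or> 7 \<notin> T"
      by (rule few; simp)+
    have "0 \<in> T \<or> f 0 = (if 0 \<in> T then f 1 else f 0)"
      "1 \<in> T \<or> f 1 = (if 0 \<in> T then f 1 else f 0)"
      "2 \<in> T \<or> f 2 = (if 0 \<in> T then f 1 else f 0)"
      "3 \<in> T \<or> f 3 = (if 0 \<in> T then f 1 else f 0)"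
      "4 \<in> T \<or> f 4 = (if 0 \<in> T then f 1 else f 0)"
      "5 \<in> T \<or> f 5 = (if 0 \<in> T then f 1 else f 0)"
      "6 \<in> T \<or> f 6 = (if 0 \<in> T then f 1 else f 0)"
      "7 \<in> T \<or> f 7 = (if 0 \<in> T then f 1 else f 0)"
      using e c by argo+
    with less_8_cases[OF that(1)] that(2) show ?thesis by metis
  qed
  show ?thesis using base[of j] base[of k] assms(3-6) by simp
qed

text \<open>
  A vertex of the 4-cycle that has lost its own port reaches another port through either of its two
  neighbours on the cycle. To cut it off, each of the three ways must be blocked, by three different
  vertices.
\<close>

lemma gadget_minus_two_reaches_port:
  fixes f :: "nat \<Rightarrow> bool"
  assumes T: "finite T" "card T \<le> 2"
    and inv: "\<forall>(j, k)\<in>gadget_edges. j \<notin> T \<longrightarrow> k \<notin> T \<longrightarrow> f j = f k"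
    and port: "\<And>j. 4 \<le> j \<Longrightarrow> j < 8 \<Longrightarrow> j \<notin> T \<Longrightarrow> f j"
    and "j < 8" "j \<notin> T"
  shows "f j"
proof -
  have few: "a \<notin> T \<or> b \<notin> T \<or> c \<notin> T" if "distinct [a, b, c]" for a b c
  proof (rule ccontr)
    assume "\<not> ?thesis"
    then have "card {a, b, c} \<le> card T" using T by (intro card_mono) auto
    then show False using that T by simp
  qed
  note e = gadget_edges_invariant[OF inv]
  have p: "4 \<in> T \<or> f 4" "5 \<in> T \<or> f 5" "6 \<in> T \<or> f 6" "7 \<in> T \<or> f 7"
    using port[of 4] port[of 5] port[of 6] port[of 7] by auto
  have c: "4 \<notin> T \<or> 1 \<notin> T \<or> 3 \<notin> T"
    "4 \<notin> T \<or> 5 \<notin> T \<or> 7 \<notin> T" "4 \<notin> T \<or> 5 \<notin> T \<or> 3 \<notin> T"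
    "4 \<notin> T \<or> 1 \<notin> T \<or> 7 \<notin> T" "5 \<notin> T \<or> 0 \<notin> T \<or> 2 \<notin> T"
    "5 \<notin> T \<or> 4 \<notin> T \<or> 6 \<notin> T" "5 \<notin> T \<or> 4 \<notin> T \<or> 2 \<notin> T"
    "5 \<notin> T \<or> 0 \<notin> T \<or> 6 \<notin> T" "6 \<notin> T \<or> 1 \<notin> T \<or> 3 \<notin> T"
    "6 \<notin> T \<or> 5 \<notin> T \<or> 7 \<notin> T" "6 \<notin> T \<or> 5 \<notin> T \<or> 3 \<notin> T"
    "6 \<notin> T \<or> 1 \<notin> T \<or> 7 \<notin> T" "7 \<notin> T \<or> 0 \<notin> T \<or> 2 \<notin> T"
    "7 \<notin> T \<or> 4 \<notin> T \<or> 6 \<notin> T" "7 \<notin> T \<or> 4 \<notin> T \<or> 2 \<notin> T"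
    "7 \<notin> T \<or> 0 \<notin> T \<or> 6 \<notin> T"
    by (rule few; simp)+
  \<comment> \<open>The triples in \<open>c\<close> are the ways to block a vertex of the cycle: its own port, and for each
    neighbour on the cycle either this neighbour or the port behind it.\<close>
  have "0 \<in> T \<or> f 0" "1 \<in> T \<or> f 1" "2 \<in> T \<or> f 2" "3 \<in> T \<or> f 3"
    using e p c by argo+
  with less_8_cases[OF \<open>j < 8\<close>] port[of j] \<open>j < 8\<close> \<open>j \<notin> T\<close> show ?thesis by auto
qed

section \<open>The necklace\<close>

definition node :: "nat \<Rightarrow> nat \<Rightarrow> nat" where
  "node i j = 8 * i + j"

lemma node_div [simp]: "j < 8 \<Longrightarrow> node i j div 8 = i"
  unfolding node_def by simp

lemma node_mod [simp]: "j < 8 \<Longrightarrow> node i j mod 8 = j"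
  unfolding node_def by simp

lemma node_div_mod [simp]: "node (v div 8) (v mod 8) = v"
  unfolding node_def by simp

lemma node_eq_iff [simp]: "j < 8 \<Longrightarrow> k < 8 \<Longrightarrow> node i j = node l k \<longleftrightarrow> i = l \<and> j = k"
  by (metis node_div node_mod)

lemma node_less_iff [simp]: "j < 8 \<Longrightarrow> node i j < 8 * m \<longleftrightarrow> i < m"
  by (metis less_mult_imp_div_less mult.commute node_div div_less_iff_less_mult zero_less_numeral)

text \<open>
  Each edge of the necklace occurs in \<open>half_arcs\<close> in one direction. In a link, the port of the left
  gadget is \<open>j + 2\<close> and that of the right gadget is \<open>j\<close>.
\<close>

definition half_arcs :: "nat \<Rightarrow> (nat \<times> nat) set" where
  "half_arcs m =
     {(node i j, node i k) | i j k. i < m \<and> (j, k) \<in> gadget_edges} \<union>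
     {(node i (j + 2), node (Suc i mod m) j) | i j. i < m \<and> j \<in> {4, 5}}"

definition necklace :: "nat \<Rightarrow> nat pair_pre_digraph" where
  "necklace m = \<lparr>pverts = {..<8 * m}, parcs = half_arcs m \<union> (half_arcs m)\<inverse>\<rparr>"

definition prev :: "nat \<Rightarrow> nat \<Rightarrow> nat" where
  "prev m i = (if i = 0 then m - 1 else i - 1)"

lemma prev_less: "i < m \<Longrightarrow> prev m i < m"
  by (auto simp: prev_def)

lemma Suc_mod_eq_iff: "i < m \<Longrightarrow> k < m \<Longrightarrow> Suc k mod m = i \<longleftrightarrow> k = prev m i"
  by (auto simp: prev_def mod_Suc)

definition nbrs :: "nat \<Rightarrow> nat \<Rightarrow> nat \<Rightarrow> nat set" where
  "nbrs m i j =
     {node i k | k. (j, k) \<in> gadget_edges \<or> (k, j) \<in> gadget_edges} \<union>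
     (if j = 4 \<or> j = 5 then {node (prev m i) (j + 2)}
      else if j = 6 \<or> j = 7 then {node (Suc i mod m) (j - 2)} else {})"

lemma pverts_necklace [simp]: "pverts (necklace m) = {..<8 * m}"
  by (simp add: necklace_def)


lemma gadget_edges_less: "(j, k) \<in> gadget_edges \<Longrightarrow> j < 8 \<and> k < 8 \<and> j \<noteq> k"
  unfolding gadget_edges_def by auto

lemma half_arcs_cases:
  assumes "(u, v) \<in> half_arcs m"
  obtains (inside) i j k where "u = node i j" "v = node i k" "i < m" "j < 8" "k < 8" "(j, k) \<in> gadget_edges"
  | (link) i j where "u = node i (j + 2)" "v = node (Suc i mod m) j" "i < m" "j \<in> {4, 5}"
  using assms gadget_edges_less unfolding half_arcs_def by blast

lemma gadget_arc:
  "i < m \<Longrightarrow> (j, k) \<in> gadget_edges \<Longrightarrow> (node i j, node i k) \<in> parcs (necklace m)"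
  unfolding necklace_def half_arcs_def by auto

lemma link_arc:
  assumes "i < m" "j \<in> {4, 5}"
  shows "(node i (j + 2), node (Suc i mod m) j) \<in> parcs (necklace m)"
proof -
  have "(node i (j + 2), node (Suc i mod m) j) \<in> half_arcs m"
    using assms unfolding half_arcs_def by blast
  then show ?thesis by (simp add: necklace_def)
qed

lemma parcs_necklace_iff:
  assumes "i < m" "j < 8"
  shows "(node i j, w) \<in> parcs (necklace m) \<longleftrightarrow> w \<in> nbrs m i j"
proof -
  have prev: "Suc (prev m i) mod m = i" "prev m i < m"
    using assms(1) Suc_mod_eq_iff prev_less by blast+
  show ?thesis
  proof
    assume "(node i j, w) \<in> parcs (necklace m)"
    then consider "(node i j, w) \<in> half_arcs m" | "(w, node i j) \<in> half_arcs m"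
      by (auto simp: necklace_def)
    then show "w \<in> nbrs m i j"
    proof cases
      case 1
      then show ?thesis
        using assms by (cases rule: half_arcs_cases) (auto simp: nbrs_def)
    next
      case 2
      then show ?thesis
      proof (cases rule: half_arcs_cases)
        case (link i' l)
        then have "Suc i' mod m = i" "l = j" using assms by auto
        then have "i' = prev m i" using assms(1) \<open>i' < m\<close> Suc_mod_eq_iff by blast
        with link \<open>l = j\<close> show ?thesis by (auto simp: nbrs_def)
      qed (use assms in \<open>auto simp: nbrs_def\<close>)
    qed
  next
    assume "w \<in> nbrs m i j"
    then consider
      k where "w = node i k" "(j, k) \<in> gadget_edges \<or> (k, j) \<in> gadget_edges"
    | "j \<in> {4, 5}" "w = node (prev m i) (j + 2)"
    | l where "l \<in> {4, 5}" "j = l + 2" "w = node (Suc i mod m) l"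
      by (auto simp: nbrs_def split: if_splits)
    then show "(node i j, w) \<in> parcs (necklace m)"
    proof cases
      case 1
      then show ?thesis using assms(1) unfolding necklace_def half_arcs_def by auto
    next
      case 2
      then have "(w, node i j) = (node (prev m i) (j + 2), node (Suc (prev m i) mod m) j)"
        using prev(1) by simp
      then have "(w, node i j) \<in> half_arcs m"
        using 2(1) prev(2) unfolding half_arcs_def by blast
      then show ?thesis by (simp add: necklace_def)
    next
      case 3
      then show ?thesis using assms(1) unfolding necklace_def half_arcs_def by auto
    qed
  qed
qed

lemma nbrs_simps:
  "nbrs m i 0 = {node i 1, node i 3, node i 4}"
  "nbrs m i 1 = {node i 0, node i 2, node i 5}"
  "nbrs m i (Suc 0) = {node i 0, node i 2, node i 5}"
  "nbrs m i 2 = {node i 1, node i 3, node i 6}"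
  "nbrs m i 3 = {node i 0, node i 2, node i 7}"
  "nbrs m i 4 = {node i 0, node i 6, node (prev m i) 6}"
  "nbrs m i 5 = {node i 1, node i 7, node (prev m i) 7}"
  "nbrs m i 6 = {node i 2, node i 4, node (Suc i mod m) 4}"
  "nbrs m i 7 = {node i 3, node i 5, node (Suc i mod m) 5}"
  unfolding nbrs_def gadget_edges_def by auto

lemma pair_graph_necklace:
  assumes "3 \<le> m"
  shows "pair_graph (necklace m)"
proof -
  have next_ne: "Suc i mod m \<noteq> i \<and> Suc i mod m < m" if "i < m" for i
    using that assms by (auto simp: mod_Suc)
  have half: "u < 8 * m \<and> v < 8 * m \<and> u \<noteq> v" if "(u, v) \<in> half_arcs m" for u v
    using that by (cases rule: half_arcs_cases) (use next_ne gadget_edges_less in auto)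
  have arcs: "e \<in> parcs (necklace m) \<Longrightarrow> fst e < 8 * m \<and> snd e < 8 * m \<and> fst e \<noteq> snd e" for e
    using half by (cases e) (auto simp: necklace_def)
  have "parcs (necklace m) \<subseteq> {..<8 * m} \<times> {..<8 * m}"
    using arcs by (auto dest!: arcs)
  then have "finite (parcs (necklace m))"
    using finite_subset by blast
  moreover have "symmetric (with_proj (necklace m))"
    unfolding symmetric_def by (simp add: necklace_def sym_Un_converse)
  ultimately show ?thesis
    using arcs by unfold_locales auto
qed

lemma node_cases:
  assumes "v < 8 * m"
  obtains i j where "v = node i j" "i < m" "j < 8"
proof -
  have "v div 8 < m"
    using assms by (simp add: less_mult_imp_div_less mult.commute)
  then show thesis
    by (intro that[of "v div 8" "v mod 8"]) simp_all
qed

lemma cubic_necklace: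
  assumes "3 \<le> m"
  shows "cubic (with_proj (necklace m))"
  unfolding cubic_def
proof
  fix v assume "v \<in> verts (with_proj (necklace m))"
  then obtain i j where v: "v = node i j" "i < m" "j < 8"
    by (auto elim: node_cases)
  have ne: "Suc i mod m \<noteq> i" "prev m i \<noteq> i"
    using \<open>i < m\<close> assms by (auto simp: mod_Suc prev_def)
  have "out_arcs (with_proj (necklace m)) v = Pair v ` nbrs m i j"
    using parcs_necklace_iff[OF v(2,3)] v(1) by (auto simp: out_arcs_def image_iff)
  then have "out_degree (with_proj (necklace m)) v = card (nbrs m i j)"
    unfolding out_degree_def by (simp add: card_image inj_on_def)
  also have "\<dots> = 3"
    using less_8_cases[OF v(3)] ne
    by (elim disjE) (simp_all add: nbrs_simps)
  finally show "out_degree (with_proj (necklace m)) v = 3" .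
qed


section \<open>Three-connectivity\<close>

text \<open>
  A cyclic sequence that changes at no position other than the one after \<open>g\<close> does not change there
  either.
\<close>

lemma cyclic_constant:
  assumes step: "\<And>i. i < m \<Longrightarrow> i \<noteq> g \<Longrightarrow> F (Suc i mod m) = F i"
    and "i < m" "j < m"
  shows "F i = F j"
proof -
  have up: "F b = F a" if "a \<le> b" "b < m" "g < a \<or> b \<le> g" for a b
    using that
  proof (induction rule: dec_induct)
    case (step n)
    then show ?case using assms(1)[of n] by auto
  qed simp
  have to_0: "F i = F 0" if "i < m" for i
  proof (cases "i \<le> g")
    case True
    then show ?thesis using up[of 0 i] that by simp
  next
    case False
    have "F (m - 1) = F i" using up[of i "m - 1"] False that by simp
    moreover have "F 0 = F (m - 1)" using step[of "m - 1"] False that by simp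
    ultimately show ?thesis by simp
  qed
  show ?thesis using to_0[OF \<open>i < m\<close>] to_0[OF \<open>j < m\<close>] by simp
qed

text \<open>
  The intact gadgets form a chain. Whatever remains of the gadget \<open>x\<close> is attached to this chain by its
  ports, since their outer neighbours lie in intact gadgets.
\<close>

lemma necklace_minus_one_gadget:
  fixes P :: "nat \<Rightarrow> bool"
  assumes m: "3 \<le> m" and "x < m" and S: "finite S" "card S \<le> 2" "\<And>v. v \<in> S \<Longrightarrow> v div 8 = x"
    and inv: "\<And>u v. (u, v) \<in> parcs (necklace m) \<Longrightarrow> u \<notin> S \<Longrightarrow> v \<notin> S \<Longrightarrow> P u = P v"
  shows "\<exists>b. \<forall>v<8 * m. v \<notin> S \<longrightarrow> P v = b"
proof -
  have clean: "node i j \<notin> S" if "i \<noteq> x" "j < 8" for i j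
    using S(3)[of "node i j"] that by auto
  have inside: "P (node i j) = P (node i k)"
    if "i < m" "(j, k) \<in> gadget_edges" "node i j \<notin> S" "node i k \<notin> S" for i j k
    using inv gadget_arc that by blast
  have link: "P (node i (j + 2)) = P (node (Suc i mod m) j)"
    if "i < m" "j \<in> {4, 5}" "node i (j + 2) \<notin> S" "node (Suc i mod m) j \<notin> S" for i j
    using inv link_arc that by blast
  have next_ne: "Suc i mod m \<noteq> i" "Suc i mod m < m" if "i < m" for i
    using that m by (auto simp: mod_Suc)
  let ?y = "Suc x mod m" and ?w = "prev m x"
  have w: "?w < m" "Suc ?w mod m = x" "?w \<noteq> x"
    using \<open>x < m\<close> m Suc_mod_eq_iff[of x m ?w] prev_less by (auto simp: prev_def)
  have gadget: "P (node i j) = P (node i k)" if "i < m" "i \<noteq> x" "j < 8" "k < 8" for i j k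
  proof (rule gadget_minus_vertex_connected[of "{}" 0 "\<lambda>j. P (node i j)"])
    show "\<forall>(j, k)\<in>gadget_edges. j \<notin> {} \<longrightarrow> k \<notin> {} \<longrightarrow> P (node i j) = P (node i k)"
      using inside[OF \<open>i < m\<close>] clean[OF \<open>i \<noteq> x\<close>] gadget_edges_less by blast
  qed (use that in auto)
  \<comment> \<open>The damaged gadget \<open>x\<close> gets the value of its successor. Then \<open>F\<close> cannot change after \<open>x\<close>, and the
    only place left where it might change is before \<open>x\<close>.\<close>
  define F where "F i = P (node (if i = x then ?y else i) 0)" for i
  have "F (Suc i mod m) = F i" if "i < m" "i \<noteq> ?w" for i
  proof (cases "i = x")
    case True
    then show ?thesis using next_ne[OF \<open>x < m\<close>] by (simp add: F_def)
  next
    case False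
    then have ne: "Suc i mod m \<noteq> x"
      using that \<open>x < m\<close> Suc_mod_eq_iff by blast
    have "P (node i 0) = P (node i 6)" using gadget that(1) False by simp
    also have "\<dots> = P (node (Suc i mod m) 4)"
      using link[of i 4] that(1) clean False ne by simp
    also have "\<dots> = P (node (Suc i mod m) 0)"
      using gadget next_ne that(1) ne by simp
    finally show ?thesis using False ne by (simp add: F_def)
  qed
  then have F: "F i = F ?w" if "i < m" for i
    using cyclic_constant[of m ?w F i ?w] that w(1) by blast
  have others: "P (node i j) = F ?w" if "i < m" "i \<noteq> x" "j < 8" for i j
    using F[OF that(1)] gadget[OF that(1,2,3), of 0] that(2) by (simp add: F_def)
  have "P (node x j) = F ?w" if "j < 8" "node x j \<notin> S" for j
  proof (rule gadget_minus_two_reaches_port[of "{j. node x j \<in> S \<and> j < 8}" "\<lambda>j. P (node x j) = F ?w"])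
    let ?T = "{j. node x j \<in> S \<and> j < 8}"
    have img: "node x ` ?T \<subseteq> S" and inj: "inj_on (node x) ?T"
      by (auto simp: inj_on_def)
    show "finite ?T" by simp
    show "card ?T \<le> 2"
      using card_inj_on_le[OF inj img S(1)] S(2) by linarith
    show "\<forall>(j, k)\<in>gadget_edges. j \<notin> ?T \<longrightarrow> k \<notin> ?T \<longrightarrow> (P (node x j) = F ?w) = (P (node x k) = F ?w)"
      using inside[OF \<open>x < m\<close>] gadget_edges_less by blast
    show "P (node x j) = F ?w" if "4 \<le> j" "j < 8" "j \<notin> ?T" for j
    proof -
      have port: "node x j \<notin> S" using that by blast
      consider "j \<in> {4, 5}" | l where "l \<in> {4, 5}" "j = l + 2"
        using \<open>4 \<le> j\<close> \<open>j < 8\<close> less_8_cases[of j] by force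
      then show ?thesis
      proof cases
        case 1
        then have "P (node ?w (j + 2)) = P (node x j)"
          using link[OF w(1), of j] w(2,3) clean port by auto
        then show ?thesis using others w(1,3) 1 by auto
      next
        case 2
        then have "P (node x j) = P (node ?y l)"
          using link[OF \<open>x < m\<close>, of l] next_ne[OF \<open>x < m\<close>] clean port by auto
        then show ?thesis using others next_ne[OF \<open>x < m\<close>] 2 by auto
      qed
    qed
  qed (use that in auto)
  with others show ?thesis
    by (metis node_cases)
qed

text \<open>
  Each gadget remains connected, so an invariant predicate has one value \<open>F i\<close> on the gadget \<open>i\<close>. An
  intact gadget keeps at least one of its two links to each side, because the gadget on that side
  has lost at most one vertex.
\<close>

lemma necklace_minus_two_gadgets:
  fixes P :: "nat \<Rightarrow> bool"
  assumes m: "3 \<le> m" and st: "s < 8 * m" "t < 8 * m" "s div 8 \<noteq> t div 8"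
    and inv: "\<And>u v. (u, v) \<in> parcs (necklace m) \<Longrightarrow> u \<notin> {s, t} \<Longrightarrow> v \<notin> {s, t} \<Longrightarrow> P u = P v"
  shows "\<exists>b. \<forall>v<8 * m. v \<notin> {s, t} \<longrightarrow> P v = b"
proof -
  let ?x = "s div 8" and ?y = "t div 8"
  have inside: "P (node i j) = P (node i k)"
    if "i < m" "(j, k) \<in> gadget_edges" "node i j \<notin> {s, t}" "node i k \<notin> {s, t}" for i j k
    using inv gadget_arc that by blast
  have link: "P (node i (j + 2)) = P (node (Suc i mod m) j)"
    if "i < m" "j \<in> {4, 5}" "node i (j + 2) \<notin> {s, t}" "node (Suc i mod m) j \<notin> {s, t}" for i j
    using inv link_arc that by blast
  have next_ne: "Suc i mod m \<noteq> i" "Suc i mod m < m" if "i < m" for i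
    using that m by (auto simp: mod_Suc)
  have hit: "node i j \<in> {s, t} \<Longrightarrow> j < 8 \<Longrightarrow> j = (if i = ?x then s mod 8 else t mod 8) \<and> i \<in> {?x, ?y}" for i j
    using st(3) by auto
  have gadget: "P (node i j) = P (node i k)"
    if "i < m" "j < 8" "k < 8" "node i j \<notin> {s, t}" "node i k \<notin> {s, t}" for i j k
  proof (rule gadget_minus_vertex_connected[of "{j. j < 8 \<and> node i j \<in> {s, t}}"
        "if i = ?x then s mod 8 else t mod 8" "\<lambda>j. P (node i j)"])
    let ?T = "{j. j < 8 \<and> node i j \<in> {s, t}}"
    show "?T \<subseteq> {if i = ?x then s mod 8 else t mod 8}"
      using hit[of i] by blast
    show "\<forall>(j, k)\<in>gadget_edges. j \<notin> ?T \<longrightarrow> k \<notin> ?T \<longrightarrow> P (node i j) = P (node i k)"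
      using inside[OF \<open>i < m\<close>] gadget_edges_less by blast
  qed (use that in auto)
  define F where "F i = (\<exists>j<8. node i j \<notin> {s, t} \<and> P (node i j))" for i
  have F: "P (node i j) = F i" if "i < m" "j < 8" "node i j \<notin> {s, t}" for i j
    using gadget[OF that(1)] that unfolding F_def by blast
  \<comment> \<open>Both links between two consecutive gadgets can be lost only if these are the damaged ones. As
    there are at least three gadgets, the damaged gadgets are consecutive in at most one of the two
    cyclic orders; when they are, \<open>g\<close> is the first of them.\<close>
  define g where "g = (if Suc ?x mod m = ?y then ?x else ?y)"
  have "F (Suc i mod m) = F i" if "i < m" "i \<noteq> g" for i
  proof -
    let ?n = "Suc i mod m"
    have "\<not> (i \<in> {?x, ?y} \<and> ?n \<in> {?x, ?y})"
    proof
      assume "i \<in> {?x, ?y} \<and> ?n \<in> {?x, ?y}"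
      then have "(i = ?x \<and> ?n = ?y) \<or> (i = ?y \<and> ?n = ?x)"
        using next_ne[OF \<open>i < m\<close>] by auto
      then have "i = ?y" "Suc ?y mod m = ?x" "Suc ?x mod m = ?y"
        using \<open>i \<noteq> g\<close> by (auto simp: g_def split: if_splits)
      then show False
        using m \<open>i < m\<close> by (auto simp: mod_Suc split: if_splits)
    qed
    then obtain l where l: "l \<in> {4, 5}" "node i (l + 2) \<notin> {s, t}" "node ?n l \<notin> {s, t}"
    proof -
      assume *: "\<not> (i \<in> {?x, ?y} \<and> ?n \<in> {?x, ?y})"
      have "node i 6 \<notin> {s, t} \<and> node ?n 4 \<notin> {s, t} \<or> node i 7 \<notin> {s, t} \<and> node ?n 5 \<notin> {s, t}"
        using * hit[of i 6] hit[of i 7] hit[of ?n 4] hit[of ?n 5]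
        by (smt (verit) numeral_eq_iff numeral_less_iff semiring_norm)
      then show thesis using that[of 4] that[of 5] by auto
    qed
    then have "F i = P (node i (l + 2))" "P (node ?n l) = F ?n"
      using F \<open>i < m\<close> next_ne(2) by auto
    with link[OF \<open>i < m\<close> l] show ?thesis by simp
  qed
  then have "F i = F 0" if "i < m" for i
    using cyclic_constant[of m g F i 0] that m by auto
  with F show ?thesis
    by (metis node_cases)
qed

lemma k_connected_necklace:
  assumes "3 \<le> m"
  shows "k_connected 3 (with_proj (necklace m))"
  unfolding k_connected_def
proof (intro conjI allI impI)
  show "3 < card (verts (with_proj (necklace m)))" using assms by simp
next
  fix S :: "nat set"
  assume "S \<subseteq> verts (with_proj (necklace m)) \<and> finite S \<and> card S < 3"
  then have S: "S \<subseteq> {..<8 * m}" "finite S" "card S \<le> 2" by auto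
  have "connected (with_proj (necklace m) \<restriction> ({..<8 * m} - S))"
  proof (rule connected_inducedI)
    have "card S < card {..<8 * m}" using S(3) assms by simp
    then show "{..<8 * m} - S \<noteq> {}" using S by (metis Diff_eq_empty_iff card_mono leD)
  next
    fix P :: "nat \<Rightarrow> bool" and u v
    assume inv: "\<And>x y. x \<in> {..<8 * m} - S \<Longrightarrow> y \<in> {..<8 * m} - S \<Longrightarrow>
        (x, y) \<in> parcs (necklace m) \<Longrightarrow> P x = P y"
      and uv: "u \<in> {..<8 * m} - S" "v \<in> {..<8 * m} - S"
    interpret pair_graph "necklace m" using assms by (rule pair_graph_necklace)
    have inv': "P x = P y" if "(x, y) \<in> parcs (necklace m)" "x \<notin> S" "y \<notin> S" for x y
      using inv that wellformed' by auto
    have "\<exists>b. \<forall>v<8 * m. v \<notin> S \<longrightarrow> P v = b"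
    proof (cases "\<exists>x<m. \<forall>v\<in>S. v div 8 = x")
      case True
      then obtain x where "x < m" "\<And>v. v \<in> S \<Longrightarrow> v div 8 = x" by blast
      then show ?thesis
        using necklace_minus_one_gadget[OF assms \<open>x < m\<close> S(2,3)] inv' by blast
    next
      case False
      have less: "v div 8 < m" if "v \<in> S" for v
        using S(1) that by (auto elim!: node_cases[of v m])
      from False assms obtain s where s: "s \<in> S" by (metis gr0I not_numeral_le_zero)
      then obtain t where t: "t \<in> S" "t div 8 \<noteq> s div 8" using False less by blast
      then have "s \<noteq> t" by blast
      then have "S = {s, t}" using s t(1) S(2,3) by (intro card_seteq[symmetric]) auto
      then show ?thesis
        using necklace_minus_two_gadgets[OF assms, of s t P] s t S(1) inv' by auto
    qed
    then show "P u = P v" using uv by auto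
  qed
  then show "connected (with_proj (necklace m) \<restriction> (verts (with_proj (necklace m)) - S))"
    by simp
qed


section \<open>Good colourings of the necklace\<close>

context pair_graph
begin

lemma good_colouring_vertex_ok:
  assumes good: "good_colouring (with_proj G) c"
    and nbrs: "\<And>w. (v, w) \<in> parcs G \<longleftrightarrow> w \<in> {x, y, z}" and dist: "distinct [x, y, z]"
  shows "vertex_ok (c v = Red) (c x = Red) (c y = Red) (c z = Red)"
proof -
  have "v \<in> pverts G" using nbrs[of x] wellformed' by blast
  then have "c v = Red \<Longrightarrow> c x = Red \<or> c y = Red \<or> c z = Red"
    using good_colouring_red[OF good, of v] nbrs by auto
  moreover have "c v = Red \<or> c x = Red \<or> c y = Red"
    "c v = Red \<or> c x = Red \<or> c z = Red" "c v = Red \<or> c y = Red \<or> c z = Red"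
    using good_colouring_blue[OF good] nbrs dist by auto
  ultimately show ?thesis unfolding vertex_ok_def by blast
qed

lemma good_colouring_edge_ok:
  assumes good: "good_colouring (with_proj G) c"
    and u: "\<And>w. (u, w) \<in> parcs G \<longleftrightarrow> w \<in> {v, x, x'}"
    and v: "\<And>w. (v, w) \<in> parcs G \<longleftrightarrow> w \<in> {u, y, y'}"
    and dist: "distinct [u, v, x, x', y, y']"
  shows "edge_ok (c u = Red) (c x = Red) (c x' = Red) (c v = Red) (c y = Red) (c y' = Red)"
proof -
  have "\<not> (c a = Red \<and> c u = Red \<and> c v = Red \<and> c b = Red)" if "a \<in> {x, x'}" "b \<in> {y, y'}" for a b
  proof (rule good_colouring_path[OF good])
    show "(a, u) \<in> parcs G" using u[of a] that by (auto intro: arcs_symmetric)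
    show "(u, v) \<in> parcs G" "(v, b) \<in> parcs G" using u v that by auto
    show "distinct [a, u, v, b]" using dist that by auto
  qed
  then show ?thesis unfolding edge_ok_def by blast
qed

end

text \<open>
  The sums over the red outer neighbours run through the neighbouring gadgets. Shifting the index
  turns them into sums over the red ports.
\<close>

lemma sum_prev: "(\<Sum>i<m. f (prev m i)) = (\<Sum>i<m. f i)"
  for f :: "nat \<Rightarrow> nat"
  by (rule sum.reindex_bij_witness[of _ "\<lambda>i. Suc i mod m" "prev m"])
    (auto simp: prev_less Suc_mod_eq_iff prev_def mod_Suc)

lemma sum_next: "(\<Sum>i<m. f (Suc i mod m)) = (\<Sum>i<m. f i)"
  for f :: "nat \<Rightarrow> nat"
  by (rule sum.reindex_bij_witness[of _ "prev m" "\<lambda>i. Suc i mod m"])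
    (auto simp: prev_less Suc_mod_eq_iff prev_def mod_Suc)

text \<open>
  Below, \<open>Q i\<close> and \<open>N i\<close> count the red ports of the gadget \<open>i\<close> and the red ones among their outer
  neighbours. The inequality \<open>Q i \<le> N i\<close> holds for each gadget and is an equality in total, so it is
  an equality for each gadget.
\<close>

lemma good_colouring_necklace_alternates:
  assumes m: "3 \<le> m" and good: "good_colouring (with_proj (necklace m)) c" and "i < m"
  shows "c (node (Suc i mod m) 4) = Red \<longleftrightarrow> c (node i 4) \<noteq> Red"
proof -
  interpret pair_graph "necklace m" using m by (rule pair_graph_necklace)
  define r where "r i j = (c (node i j) = Red)" for i j
  define Q where "Q i = (of_bool (r i 4) + of_bool (r i 5) + of_bool (r i 6) + of_bool (r i 7) :: nat)" for i
  define N where "N i = (of_bool (r (prev m i) 6) + of_bool (r (prev m i) 7)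
    + of_bool (r (Suc i mod m) 4) + of_bool (r (Suc i mod m) 5) :: nat)" for i
  have balance: "Q i \<le> N i \<and> (Q i = N i \<longrightarrow> r (Suc i mod m) 4 = r i 6 \<and> r i 4 = (\<not> r i 6))" if i: "i < m" for i
  proof -
    let ?n = "Suc i mod m" and ?p = "prev m i"
    have ne: "?n \<noteq> i" "?p \<noteq> i" "i \<noteq> ?n" "i \<noteq> ?p"
      using i m by (auto simp: mod_Suc prev_def)
    have vertex_ok: "vertex_ok (r i j) (r a a') (r b b') (r d d')"
      if "nbrs m i j = {node a a', node b b', node d d'}" "distinct [node a a', node b b', node d d']" "j < 8"
      for j a a' b b' d d'
      unfolding r_def by (rule good_colouring_vertex_ok[OF good])
        (use that parcs_necklace_iff[OF i that(3)] in auto)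
    have edge_ok: "edge_ok (r i j) (r a a') (r b b') (r i k) (r d d') (r e e')"
      if "nbrs m i j = {node i k, node a a', node b b'}" "nbrs m i k = {node i j, node d d', node e e'}"
        "distinct [node i j, node i k, node a a', node b b', node d d', node e e']" "j < 8" "k < 8"
      for j k a a' b b' d d' e e'
      unfolding r_def by (rule good_colouring_edge_ok[OF good])
        (use that parcs_necklace_iff[OF i that(4)] parcs_necklace_iff[OF i that(5)] in auto)
    have hyps:
      "vertex_ok (r i 0) (r i 1) (r i 3) (r i 4)" "vertex_ok (r i 1) (r i 0) (r i 2) (r i 5)"
      "vertex_ok (r i 2) (r i 1) (r i 3) (r i 6)" "vertex_ok (r i 3) (r i 0) (r i 2) (r i 7)"
      "vertex_ok (r i 4) (r i 0) (r i 6) (r ?p 6)" "vertex_ok (r i 5) (r i 1) (r i 7) (r ?p 7)"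
      "vertex_ok (r i 6) (r i 2) (r i 4) (r ?n 4)" "vertex_ok (r i 7) (r i 3) (r i 5) (r ?n 5)"
      "edge_ok (r i 0) (r i 3) (r i 4) (r i 1) (r i 2) (r i 5)"
      "edge_ok (r i 1) (r i 0) (r i 5) (r i 2) (r i 3) (r i 6)"
      "edge_ok (r i 2) (r i 1) (r i 6) (r i 3) (r i 0) (r i 7)"
      "edge_ok (r i 3) (r i 2) (r i 7) (r i 0) (r i 1) (r i 4)"
      "edge_ok (r i 0) (r i 1) (r i 3) (r i 4) (r i 6) (r ?p 6)"
      "edge_ok (r i 1) (r i 0) (r i 2) (r i 5) (r i 7) (r ?p 7)"
      "edge_ok (r i 2) (r i 1) (r i 3) (r i 6) (r i 4) (r ?n 4)"
      "edge_ok (r i 3) (r i 0) (r i 2) (r i 7) (r i 5) (r ?n 5)"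
      "edge_ok (r i 4) (r i 0) (r ?p 6) (r i 6) (r i 2) (r ?n 4)"
      "edge_ok (r i 5) (r i 1) (r ?p 7) (r i 7) (r i 3) (r ?n 5)"
      by ((rule vertex_ok | rule edge_ok); use ne in \<open>auto simp: nbrs_simps\<close>)+
    show ?thesis
      using gadget_balance[OF hyps] unfolding Q_def N_def by simp
  qed
  have "(\<Sum>i<m. Q i) = (\<Sum>i<m. N i)"
    unfolding Q_def N_def sum.distrib
      sum_prev[of "\<lambda>i. of_bool (r i 6)"] sum_prev[of "\<lambda>i. of_bool (r i 7)"]
      sum_next[of "\<lambda>i. of_bool (r i 4)"] sum_next[of "\<lambda>i. of_bool (r i 5)"]
    by simp
  then have "Q i = N i"
    using sum_mono_inv[of Q "{..<m}" N i] balance \<open>i < m\<close> by auto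
  with balance[OF \<open>i < m\<close>] show ?thesis unfolding r_def by blast
qed

lemma no_good_colouring_odd_necklace:
  assumes m: "3 \<le> m" and "odd m"
  shows "\<not> good_colouring (with_proj (necklace m)) c"
proof
  assume good: "good_colouring (with_proj (necklace m)) c"
  note alternates = good_colouring_necklace_alternates[OF m good]
  have "i < m \<Longrightarrow> c (node i 4) = Red \<longleftrightarrow> (c (node 0 4) = Red \<longleftrightarrow> even i)" for i
  proof (induction i)
    case (Suc i)
    then show ?case using alternates[of i] by auto
  qed simp
  from this[of "m - 1"] have "c (node (m - 1) 4) = Red \<longleftrightarrow> c (node 0 4) = Red"
    using m \<open>odd m\<close> by auto
  then show False using alternates[of "m - 1"] m by auto
qed

section \<open>The infinite family\<close>

lemma digraph_iso_card_verts:
  assumes "digraph_iso G H"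
  shows "card (verts G) = card (verts H)"
  using assms unfolding digraph_iso_def pre_digraph.digraph_isomorphism_def
  by (auto simp: card_image)

theorem corollary8:
  shows "\<exists>F :: nat pair_pre_digraph set. infinite F \<and>
    (\<forall>G\<in>F. \<forall>H\<in>F. G \<noteq> H \<longrightarrow> \<not> digraph_iso (with_proj G) (with_proj H)) \<and>
    (\<forall>G\<in>F. pair_graph G \<and> k_connected 3 (with_proj G) \<and> cubic (with_proj G) \<and>
       \<not> (\<exists>c. good_colouring (with_proj G) c))"
proof (intro exI[of _ "range (\<lambda>n. necklace (2 * n + 3))"] conjI ballI impI)
  have "inj (\<lambda>n. necklace (2 * n + 3))"
  proof (rule injI)
    fix n k assume "necklace (2 * n + 3) = necklace (2 * k + 3)"
    then have "card (pverts (necklace (2 * n + 3))) = card (pverts (necklace (2 * k + 3)))" by simp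
    then show "n = k" by simp
  qed
  then show "infinite (range (\<lambda>n. necklace (2 * n + 3)))"
    by (rule range_inj_infinite)
next
  fix G H
  assume GH: "G \<in> range (\<lambda>n. necklace (2 * n + 3))" "H \<in> range (\<lambda>n. necklace (2 * n + 3))" "G \<noteq> H"
  show "\<not> digraph_iso (with_proj G) (with_proj H)"
  proof
    assume "digraph_iso (with_proj G) (with_proj H)"
    from digraph_iso_card_verts[OF this] GH show False by auto
  qed
next
  fix G assume "G \<in> range (\<lambda>n. necklace (2 * n + 3))"
  then obtain n where G: "G = necklace (2 * n + 3)" by blast
  show "pair_graph G" "k_connected 3 (with_proj G)" "cubic (with_proj G)"
    unfolding G by (simp_all add: pair_graph_necklace k_connected_necklace cubic_necklace)
  show "\<not> (\<exists>c. good_colouring (with_proj G) c)"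
    unfolding G by (simp add: no_good_colouring_odd_necklace)
qed

end
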